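(* Let $f:\mathbb{R}^n\to\mathbb{R}$ be a $\mathcal{C}^1$-smooth function whose gradient is locally Lipschitz continuous on $\mathbb{R}^n$. Let $\{x^k\}$ be the sequence of iterates generated by Algorithm DFB (described in the context). Assume that $\nabla f(x^k)\neq0$ for all $k\in\mathbb{N}$ and that $\{x^k\}$ is bounded. Then: (i) If $\bar x$ is an accumulation point of $\{x^k\}$ and $f$ satisfies the KL property at $\bar x$, then $x^k\to\bar x$ as $k\to\infty$. (ii) If in addition to the assumptions of (i) the KL property at $\bar x$ is satisfied with $\psi(t)=Mt^{q}$ for some $M>0$ and $q\in(0,1)$, then the following convergence rates are guaranteed: - If $q\in(0,1/2]$, then the sequence $\{x^k\}$ converges linearly to $\bar x$. - If $q\in(1/2,1)$, then $\|x^k-\bar x\|=\mathcal{O}\big(k^{-\frac{1-q}{2q-1}}\big)$ as $k\to\infty$.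
   Context: $\|\cdot\|$ is the Euclidean norm on $\mathbb{R}^n$ and $\mathbb{N}=\{1,2,\dots\}$. Local Lipschitz continuity of $\nabla f$ on $\mathbb{R}^n$ means Lipschitz continuity on every compact subset of $\mathbb{R}^n$. Local approximation: a mapping $\mathcal{G}:\mathbb{R}^n\times(0,\infty)\to\mathbb{R}^n$ is a local approximation of $\nabla f$ if for any bounded set $\Omega\subset\mathbb{R}^n$ and any $\Delta>0$ there is $C>0$ such that $\|\mathcal{G}(x,\delta)-\nabla f(x)\|\le C\delta$ for all $(x,\delta)\in\Omega\times(0,\Delta]$. Algorithm DFB. Step 0: Choose a local approximation $\mathcal{G}$ of $\nabla f$, an initial point $x^1\in\mathbb{R}^n$, an initial radius $\delta_1>0$, a constant $C_1>0$, factors $\theta\in(0,1)$, $\mu>2$, $\eta>1$, linesearch constants $\beta\in(0,1/2)$, $\gamma\in(0,1)$, $\bar\tau>0$, an initial bound $t_1^{\min}\in(0,\bar\tau)$, and a sequence $\{\nu_k\}\subset(0,\infty)$ with $\nu_k\downarrow0$ as $k\to\infty$. Set $k:=1$. Step 1: Select $g^k$ and the smallest nonnegative integer $i_k$ so that $g^k=\mathcal{G}(x^k,\min\{\theta^{i_k}\delta_k,\nu_k\})$ and $\|g^k\|>\mu C_k\theta^{i_k}\delta_k$ (such $g^k,i_k$ exist whenever $\nabla f(x^k)\neq0$). Set $\delta_{k+1}:=\theta^{i_k}\delta_k$. Step 2: Set $t_k:=\bar\tau$. While $f(x^k-t_kg^k)>f(x^k)-\beta t_k\|g^k\|^2$ and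 $t_k\ge t_k^{\min}$, set $t_k:=\gamma t_k$. Step 3: If $t_k\ge t_k^{\min}$, then set $\tau_k:=t_k$, $C_{k+1}:=C_k$, $t_{k+1}^{\min}:=t_k^{\min}$. Otherwise, set $\tau_k:=0$, $C_{k+1}:=\eta C_k$, $t_{k+1}^{\min}:=\gamma t_k^{\min}$. Step 4: Set $x^{k+1}:=x^k-\tau_kg^k$. Increase $k$ by $1$ and go back to Step 1. KL property: a differentiable $f:\mathbb{R}^n\to\mathbb{R}$ satisfies the KL property at $\bar x$ if there exist a number $\eta'>0$, a neighborhood $U$ of $\bar x$, and a nondecreasing function $\psi:(0,\eta')\to(0,\infty)$ such that $1/\psi$ is integrable over $(0,\eta')$ and $\|\nabla f(x)\|\ge\psi\big(f(x)-f(\bar x)\big)$ for all $x\in U$ with $f(\bar x)<f(x)<f(\bar x)+\eta'$. "With $\psi(t)=Mt^q$" means that this holds with that particular $\psi$ for some $\eta'$ and $U$. A sequence $\{x^k\}$ converges linearly to $\bar x$ if there are $c>0$ and $\rho\in(0,1)$ with $\|x^k-\bar x\|\le c\rho^k$ for all sufficiently large $k$. *)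

theory Defs
  imports
    "HOL-Analysis.Analysis"
    "HOL-Library.Landau_Symbols"
    "HOL-Library.While_Combinator"
begin

definition grad :: "(real^'n \<Rightarrow> real) \<Rightarrow> real^'n \<Rightarrow> real^'n" where
  "grad f x = (THE D. GDERIV f x :> D)"

lemma grad_eqI:
  assumes "GDERIV f x :> D"
  shows "grad f x = D"
  unfolding grad_def
proof (rule the_equality)
  show "GDERIV f x :> D" by (fact assms)
next
  fix D' assume "GDERIV f x :> D'"
  then have "(\<lambda>h. h \<bullet> D') = (\<lambda>h. h \<bullet> D)"
    using assms unfolding gderiv_def by (rule has_derivative_unique)
  then have "(D' - D) \<bullet> D' = (D' - D) \<bullet> D"
    by (rule fun_cong)
  then have "(D' - D) \<bullet> (D' - D) = 0"
    by (simp add: inner_diff_right)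
  then show "D' = D"
    by simp
qed

definition C1_smooth :: "(real^'n \<Rightarrow> real) \<Rightarrow> bool" where
  "C1_smooth f \<longleftrightarrow> (\<forall>x. f differentiable (at x)) \<and> continuous_on UNIV (grad f)"

text \<open>
  Lipschitz continuity on every compact set; the library's \<open>local_lipschitz\<close> is phrased
  with neighbourhoods and an additional time parameter.
\<close>
definition locally_Lipschitz :: "(real^'n \<Rightarrow> real^'n) \<Rightarrow> bool" where
  "locally_Lipschitz F \<longleftrightarrow> (\<forall>K. compact K \<longrightarrow> (\<exists>L. L-lipschitz_on K F))"

text \<open>
  The values of \<open>G\<close> at nonpositive radii are irrelevant.
\<close>
definition local_approximation ::
    "(real^'n \<Rightarrow> real \<Rightarrow> real^'n) \<Rightarrow> (real^'n \<Rightarrow> real^'n) \<Rightarrow> bool" where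
  "local_approximation G F \<longleftrightarrow>
     (\<forall>\<Omega> \<Delta>. bounded \<Omega> \<and> \<Delta> > 0 \<longrightarrow>
        (\<exists>c>0. \<forall>x\<in>\<Omega>. \<forall>\<delta>\<in>{0<..\<Delta>}. norm (G x \<delta> - F x) \<le> c * \<delta>))"

text \<open>
  One complete run of the derivative-free backtracking (DFB) method. Sequences are indexed
  from \<open>1\<close>; their values at \<open>0\<close> are unconstrained. The notation \<open>\<nu>\<^sub>k \<down> 0\<close> is read as
  nonincreasing convergence to \<open>0\<close>.
  In iteration \<open>k\<close>, \<open>t k\<close> is the value with which the backtracking loop exits (it
  terminates because \<open>tmin k > 0\<close> and \<open>0 < \<gamma> < 1\<close>), and \<open>\<tau> k\<close> is the stepsize actually used.
\<close>
locale DFB =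
  fixes f :: "real^'n \<Rightarrow> real"
    and G :: "real^'n \<Rightarrow> real \<Rightarrow> real^'n"
    and \<theta> \<mu> \<eta> \<beta> \<gamma> \<tau>bar :: real
    and \<nu> :: "nat \<Rightarrow> real"
    and x g :: "nat \<Rightarrow> real^'n"
    and i :: "nat \<Rightarrow> nat"
    and \<delta> C tmin t \<tau> :: "nat \<Rightarrow> real"
  assumes approx: "local_approximation G (grad f)"
    and delta_1: "\<delta> 1 > 0"
    and C_1: "C 1 > 0"
    and theta: "0 < \<theta>" "\<theta> < 1"
    and mu: "\<mu> > 2"
    and eta: "\<eta> > 1"
    and beta: "0 < \<beta>" "\<beta> < 1/2"
    and gamma: "0 < \<gamma>" "\<gamma> < 1"
    and taubar: "\<tau>bar > 0"
    and tmin_1: "0 < tmin 1" "tmin 1 < \<tau>bar"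
    and nu_pos: "\<And>k. k \<ge> 1 \<Longrightarrow> \<nu> k > 0"
    and nu_antimono: "\<And>k. k \<ge> 1 \<Longrightarrow> \<nu> (Suc k) \<le> \<nu> k"
    and nu_lim: "\<nu> \<longlonglongrightarrow> 0"
    and step1_g: "\<And>k. k \<ge> 1 \<Longrightarrow> g k = G (x k) (min (\<theta> ^ i k * \<delta> k) (\<nu> k))"
    and step1_accept: "\<And>k. k \<ge> 1 \<Longrightarrow> norm (g k) > \<mu> * C k * \<theta> ^ i k * \<delta> k"
    and step1_least: "\<And>k j. k \<ge> 1 \<Longrightarrow> j < i k \<Longrightarrow>
      \<not> norm (G (x k) (min (\<theta> ^ j * \<delta> k) (\<nu> k))) > \<mu> * C k * \<theta> ^ j * \<delta> k"
    and step1_delta: "\<And>k. k \<ge> 1 \<Longrightarrow> \<delta> (Suc k) = \<theta> ^ i k * \<delta> k"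
    and step2: "\<And>k. k \<ge> 1 \<Longrightarrow>
      t k = while (\<lambda>s. f (x k - s *\<^sub>R g k) > f (x k) - \<beta> * s * (norm (g k))\<^sup>2 \<and> s \<ge> tmin k)
                  (\<lambda>s. \<gamma> * s) \<tau>bar"
    and step3_success: "\<And>k. k \<ge> 1 \<Longrightarrow> t k \<ge> tmin k \<Longrightarrow>
      \<tau> k = t k \<and> C (Suc k) = C k \<and> tmin (Suc k) = tmin k"
    and step3_failure: "\<And>k. k \<ge> 1 \<Longrightarrow> \<not> t k \<ge> tmin k \<Longrightarrow>
      \<tau> k = 0 \<and> C (Suc k) = \<eta> * C k \<and> tmin (Suc k) = \<gamma> * tmin k"
    and step4: "\<And>k. k \<ge> 1 \<Longrightarrow> x (Suc k) = x k - \<tau> k *\<^sub>R g k"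

definition accumulation_point :: "(nat \<Rightarrow> real^'n) \<Rightarrow> real^'n \<Rightarrow> bool" where
  "accumulation_point x xbar \<longleftrightarrow>
     (\<exists>r :: nat \<Rightarrow> nat. strict_mono r \<and> (x \<circ> r) \<longlonglongrightarrow> xbar)"

definition KL_property_with ::
    "(real^'n \<Rightarrow> real) \<Rightarrow> real^'n \<Rightarrow> (real \<Rightarrow> real) \<Rightarrow> bool" where
  "KL_property_with f xbar \<psi> \<longleftrightarrow>
     (\<exists>\<epsilon>>0. \<exists>U. open U \<and> xbar \<in> U \<and>
        (\<forall>s\<in>{0<..<\<epsilon>}. \<psi> s > 0) \<and>
        mono_on {0<..<\<epsilon>} \<psi> \<and>
        set_integrable lborel {0<..<\<epsilon>} (\<lambda>s. 1 / \<psi> s) \<and>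
        (\<forall>y\<in>U. f xbar < f y \<and> f y < f xbar + \<epsilon> \<longrightarrow> norm (grad f y) \<ge> \<psi> (f y - f xbar)))"

definition KL_property :: "(real^'n \<Rightarrow> real) \<Rightarrow> real^'n \<Rightarrow> bool" where
  "KL_property f xbar \<longleftrightarrow> (\<exists>\<psi>. KL_property_with f xbar \<psi>)"

definition converges_linearly :: "(nat \<Rightarrow> real^'n) \<Rightarrow> real^'n \<Rightarrow> bool" where
  "converges_linearly x xbar \<longleftrightarrow>
     (\<exists>c>0. \<exists>\<rho>\<in>{0<..<1}. \<forall>\<^sub>F k in sequentially. norm (x k - xbar) \<le> c * \<rho> ^ k)"

end

theory Submission
  imports Defs
begin

text \<open>
  The proof separates what is special about the algorithm from the standard Kurdyka-Lojasiewicz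
  argument for descent methods.

  The special part is that only finitely many linesearches fail
  (\<open>finitely_many_failures\<close>). Every failure multiplies \<open>C\<close> by \<open>\<eta> > 1\<close> and \<open>tmin\<close> by
  \<open>\<gamma> < 1\<close>. After enough failures \<open>C\<close> exceeds the unknown constant in the error bound of the
  approximation \<open>G\<close>, and then the acceptance test forces the error of \<open>g k\<close> below half its norm;
  so \<open>- g k\<close> is a descent direction, and because the gradient is Lipschitz near the bounded
  iterates, the Armijo inequality holds for all steps below a fixed threshold. Once \<open>tmin\<close> is
  small compared with that threshold, no further failure can occur.

  From then on \<open>C\<close> and \<open>tmin\<close> are constant. The limiting value of \<open>C\<close> need not dominate the
  error constant, but the acceptance test still bounds the radius, hence the error, by a multiple
  of \<open>norm (g k)\<close>. So the true gradient is bounded by a multiple of \<open>g k\<close>, and the Armijo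
  inequality becomes two inequalities in which neither \<open>G\<close> nor the parameters occur: the decrease
  of \<open>f\<close> dominates the gradient norm times the length of the step, and also the square of the
  gradient norm (\<open>eventually_descent_sequence\<close>).

  For such a sequence, let \<open>\<phi>\<close> be a primitive of \<open>1 / \<psi>\<close>. As \<open>\<psi>\<close> is nondecreasing, \<open>\<phi>\<close> satisfies
  the tangent inequality of a concave function, so that near the accumulation point \<open>z\<close> the KL
  inequality bounds each step length by a multiple of the decrease of \<open>\<phi> (f (x k) - f z)\<close>. These
  decreases telescope. Hence the sequence cannot leave a small neighbourhood of \<open>z\<close> once it is
  close enough, it has finite length and converges, and its distance to \<open>z\<close> is at most a multiple
  of \<open>\<phi> (f (x k) - f z)\<close> (\<open>KL_convergence\<close>).

  If \<open>\<psi> s = M * s powr q\<close>, then \<open>\<phi> s\<close> is a multiple of \<open>s powr (1 - q)\<close>, while the second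
  inequality gives the recursion \<open>r (k+1) \<le> r k - c * r k powr (2 * q)\<close> for the value gap \<open>r\<close>.
  Its decay is geometric for \<open>q \<le> 1/2\<close>; for \<open>q > 1/2\<close> the quantity \<open>r powr (1 - 2 * q)\<close> grows at
  least linearly in \<open>k\<close> (\<open>linear_decay\<close>, \<open>polynomial_decay\<close>).
\<close>

section \<open>Gradients and descent\<close>

lemma differentiable_GDERIV_grad:
  assumes "f differentiable (at x)"
  shows "GDERIV f x :> grad f x"
proof -
  obtain f' where f': "(f has_derivative f') (at x)"
    using assms unfolding differentiable_def by blast
  then have lin: "linear f'"
    by (rule has_derivative_linear)
  have "f' h = h \<bullet> (\<Sum>b\<in>Basis. f' b *\<^sub>R b)" for h
  proof -
    have "f' h = f' (\<Sum>b\<in>Basis. (h \<bullet> b) *\<^sub>R b)"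
      by (simp add: euclidean_representation)
    also have "\<dots> = (\<Sum>b\<in>Basis. (h \<bullet> b) * f' b)"
      by (simp add: linear_sum[OF lin] linear_scale[OF lin])
    finally show ?thesis
      by (simp add: inner_sum_right mult.commute)
  qed
  then have "GDERIV f x :> (\<Sum>b\<in>Basis. f' b *\<^sub>R b)"
    using f' unfolding gderiv_def by (metis (no_types, lifting) ext)
  then show ?thesis
    using grad_eqI by metis
qed

lemma C1_smooth_isCont:
  assumes "C1_smooth f"
  shows "isCont f x"
  using assms by (simp add: C1_smooth_def differentiable_imp_continuous_within)

text \<open>
  The mean value theorem, with the gradient at the intermediate point compared to the one at \<open>x\<close>.
  The sharp constant would be \<open>L / 2\<close>; only the order of the remainder matters here.
\<close>
lemma lipschitz_gradient_upper_bound: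
  assumes diff: "\<And>y. f differentiable (at y)"
    and lip: "L-lipschitz_on S (grad f)"
    and S: "convex S" "x \<in> S" "x + d \<in> S"
  shows "f (x + d) \<le> f x + d \<bullet> grad f x + L * (norm d)\<^sup>2"
proof -
  have "((\<lambda>s::real. f (x + s *\<^sub>R d)) has_derivative (\<lambda>h. (h *\<^sub>R d) \<bullet> grad f (x + s *\<^sub>R d)))
      (at s within {0..1})" for s
  proof -
    have "((\<lambda>s. x + s *\<^sub>R d) has_derivative (\<lambda>h. h *\<^sub>R d)) (at s within {0..1})"
      by (auto intro!: derivative_eq_intros)
    then show ?thesis
      using differentiable_GDERIV_grad[OF diff, of "x + s *\<^sub>R d"] unfolding gderiv_def
      by (rule has_derivative_compose)
  qed
  then obtain s where s: "0 < s" "s < 1"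
    and eq: "f (x + 1 *\<^sub>R d) - f (x + 0 *\<^sub>R d) = ((1 - 0) *\<^sub>R d) \<bullet> grad f (x + s *\<^sub>R d)"
    using mvt_simple[of 0 1 "\<lambda>s. f (x + s *\<^sub>R d)" "\<lambda>s h. (h *\<^sub>R d) \<bullet> grad f (x + s *\<^sub>R d)"]
    by auto
  let ?z = "x + s *\<^sub>R d"
  have "?z = (1 - s) *\<^sub>R x + s *\<^sub>R (x + d)"
    by (simp add: algebra_simps)
  then have "?z \<in> S"
    using S s convexD[OF S(1), of x "x + d" "1 - s" s] by simp
  then have "norm (grad f ?z - grad f x) \<le> L * norm (s *\<^sub>R d)"
    using lipschitz_onD[OF lip, of ?z x] S by (simp add: dist_norm)
  also have "\<dots> \<le> L * norm d"
    using s lipschitz_on_nonneg[OF lip]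
    by (intro mult_left_mono) (auto simp: mult_left_le_one_le)
  finally have "norm d * norm (grad f ?z - grad f x) \<le> norm d * (L * norm d)"
    by (rule mult_left_mono) simp
  moreover have "d \<bullet> (grad f ?z - grad f x) \<le> norm d * norm (grad f ?z - grad f x)"
    by (rule norm_cauchy_schwarz)
  ultimately show ?thesis
    using eq by (simp add: inner_diff_right power2_eq_square algebra_simps)
qed

section \<open>Backtracking\<close>

text \<open>
  What matters about the exit value of a backtracking loop, besides the negated loop condition, is
  that any reduced value comes from a rejected trial value \<open>u\<close>. The loop terminates because
  its condition forces \<open>m \<le> u\<close>, which a geometric sequence violates eventually; the
  proof is an induction on the number of reductions that bring \<open>s\<close> below \<open>m\<close>.
\<close>
lemma backtracking_exit:
  fixes s c m :: real
  assumes "0 < c" "c < 1" "0 < m" "0 < s"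
    and "\<And>u. P u \<Longrightarrow> m \<le> u"
  defines "e \<equiv> while P (\<lambda>u. c * u) s"
  shows "\<not> P e \<and> 0 < e \<and> e \<le> s \<and> (e = s \<or> (\<exists>u. 0 < u \<and> u \<le> s \<and> P u \<and> e = c * u))"
proof -
  obtain n where "c ^ n < m / s"
    using real_arch_pow_inv[of "m / s" c] assms by auto
  then have "c ^ n * s < m"
    using assms by (simp add: field_simps)
  then show ?thesis
    using \<open>0 < s\<close> unfolding e_def
  proof (induction n arbitrary: s)
    case 0
    then have "\<not> P s"
      using assms(5)[of s] by auto
    then have "while P (\<lambda>u. c * u) s = s"
      by (subst while_unfold) simp
    then show ?case
      using 0 \<open>\<not> P s\<close> by simp
  next
    case (Suc n)
    show ?case
    proof (cases "P s")
      case True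
      let ?e = "while P (\<lambda>u. c * u) (c * s)"
      have le: "c * s \<le> s"
        using Suc.prems assms(2) by simp
      have IH: "\<not> P ?e \<and> 0 < ?e \<and> ?e \<le> c * s \<and>
          (?e = c * s \<or> (\<exists>u. 0 < u \<and> u \<le> c * s \<and> P u \<and> ?e = c * u))"
        using Suc.prems assms(1) by (intro Suc.IH) (auto simp: mult_ac)
      then have "?e = c * s \<or> (\<exists>u. 0 < u \<and> u \<le> s \<and> P u \<and> ?e = c * u)"
        using le by fastforce
      then have "\<exists>u. 0 < u \<and> u \<le> s \<and> P u \<and> ?e = c * u"
        using True Suc.prems(2) by blast
      moreover have "while P (\<lambda>u. c * u) s = ?e"
        using True by (subst while_unfold) simp
      ultimately show ?thesis
        using IH le by simp
    next
      case False
      then have "while P (\<lambda>u. c * u) s = s"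
        by (subst while_unfold) simp
      then show ?thesis
        using Suc.prems False by simp
    qed
  qed
qed

context DFB
begin

lemma delta_bounds:
  assumes "k \<ge> 1"
  shows "0 < \<delta> k" "\<delta> k \<le> \<delta> 1"
proof -
  have "0 < \<delta> k \<and> \<delta> k \<le> \<delta> 1"
    using assms
  proof (induction k rule: dec_induct)
    case base
    show ?case using delta_1 by simp
  next
    case (step k)
    have "0 < \<theta> ^ i k" "\<theta> ^ i k \<le> 1"
      using theta by (auto intro: power_le_one)
    then have "0 < \<theta> ^ i k * \<delta> k" "\<theta> ^ i k * \<delta> k \<le> \<delta> k"
      using step mult_left_le_one_le[of "\<delta> k" "\<theta> ^ i k"] by auto
    then show ?case
      using step(3) unfolding step1_delta[OF step(1)] by (intro conjI; linarith)
  qed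
  then show "0 < \<delta> k" "\<delta> k \<le> \<delta> 1" by auto
qed

lemma parameters_step:
  assumes "k \<ge> 1"
  shows "t k \<ge> tmin k \<and> C (Suc k) = C k \<and> tmin (Suc k) = tmin k \<or>
    t k < tmin k \<and> C (Suc k) = \<eta> * C k \<and> tmin (Suc k) = \<gamma> * tmin k"
  using step3_success[OF assms] step3_failure[OF assms] by fastforce

text \<open>
  Positivity and monotonicity of the adaptive parameters, in one statement because monotonicity
  relies on positivity.
\<close>
lemma parameters_mono:
  assumes "1 \<le> j" "j \<le> k"
  shows "0 < C j \<and> 0 < tmin j \<and> C j \<le> C k \<and> tmin k \<le> tmin j"
proof -
  have pos: "0 < C j \<and> 0 < tmin j" if "1 \<le> j" for j
    using that
  proof (induction j rule: dec_induct)
    case base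
    show ?case using C_1 tmin_1 by simp
  next
    case (step j)
    then show ?case
      using parameters_step[of j] eta gamma by auto
  qed
  have "C j \<le> C k \<and> tmin k \<le> tmin j"
    using assms(2)
  proof (induction k rule: dec_induct)
    case base
    show ?case by simp
  next
    case (step k)
    have "C k \<le> \<eta> * C k" "\<gamma> * tmin k \<le> tmin k"
      using pos[of k] assms step eta gamma by auto
    then show ?case
      using parameters_step[of k] assms step by auto
  qed
  then show ?thesis using pos assms by auto
qed

text \<open>
  A failed linesearch exits below \<open>tmin k\<close>, hence below \<open>\<tau>bar\<close>, so at least one reduction took
  place; the last rejected trial step \<open>u\<close> violates the Armijo inequality, and \<open>\<gamma> * u\<close> is the exit
  value.
\<close>
lemma linesearch_exit:
  assumes "k \<ge> 1"
  shows "0 < t k" "t k \<le> \<tau>bar"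
    and "t k \<ge> tmin k \<Longrightarrow> f (x k - t k *\<^sub>R g k) \<le> f (x k) - \<beta> * t k * (norm (g k))\<^sup>2"
    and "t k < tmin k \<Longrightarrow> \<exists>u>0. u \<le> \<tau>bar \<and> \<gamma> * u < tmin k \<and>
      f (x k - u *\<^sub>R g k) > f (x k) - \<beta> * u * (norm (g k))\<^sup>2"
proof -
  let ?P = "\<lambda>s. f (x k - s *\<^sub>R g k) > f (x k) - \<beta> * s * (norm (g k))\<^sup>2 \<and> s \<ge> tmin k"
  have tmin: "0 < tmin k" "tmin k < \<tau>bar"
    using parameters_mono[of k k] parameters_mono[of 1 k] assms tmin_1 by auto
  have exit: "\<not> ?P (t k) \<and> 0 < t k \<and> t k \<le> \<tau>bar \<and>
      (t k = \<tau>bar \<or> (\<exists>u. 0 < u \<and> u \<le> \<tau>bar \<and> ?P u \<and> t k = \<gamma> * u))"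
    unfolding step2[OF assms]
    by (rule backtracking_exit[of \<gamma> "tmin k"]) (use gamma taubar tmin in auto)
  show "0 < t k" "t k \<le> \<tau>bar"
    using exit by auto
  show "f (x k - t k *\<^sub>R g k) \<le> f (x k) - \<beta> * t k * (norm (g k))\<^sup>2" if "t k \<ge> tmin k"
    using exit that by auto
  show "\<exists>u>0. u \<le> \<tau>bar \<and> \<gamma> * u < tmin k \<and>
      f (x k - u *\<^sub>R g k) > f (x k) - \<beta> * u * (norm (g k))\<^sup>2" if "t k < tmin k"
    using exit that tmin by force
qed

lemma parameters_after_failures:
  assumes "infinite {k. k \<ge> 1 \<and> t k < tmin k}"
  shows "\<exists>k0\<ge>1. \<forall>k\<ge>k0. \<eta> ^ n * C 1 \<le> C k \<and> tmin k \<le> \<gamma> ^ n * tmin 1"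
proof (induction n)
  case 0
  show ?case
    using parameters_mono by (intro exI[of _ 1]) auto
next
  case (Suc n)
  then obtain k0 where k0: "1 \<le> k0"
    and IH: "\<And>k. k \<ge> k0 \<Longrightarrow> \<eta> ^ n * C 1 \<le> C k \<and> tmin k \<le> \<gamma> ^ n * tmin 1"
    by blast
  obtain j where j: "j > k0" "t j < tmin j"
    using assms unfolding infinite_nat_iff_unbounded by blast
  have upd: "C (Suc j) = \<eta> * C j" "tmin (Suc j) = \<gamma> * tmin j"
    using parameters_step[of j] j k0 by auto
  have "\<eta> ^ Suc n * C 1 \<le> C k \<and> tmin k \<le> \<gamma> ^ Suc n * tmin 1" if "k \<ge> Suc j" for k
  proof -
    have "\<eta> * (\<eta> ^ n * C 1) \<le> \<eta> * C j" "\<gamma> * tmin j \<le> \<gamma> * (\<gamma> ^ n * tmin 1)"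
      using IH[of j] j eta gamma by (auto intro!: mult_left_mono)
    then show ?thesis
      using parameters_mono[of "Suc j" k] that upd by (auto simp: mult.assoc)
  qed
  then show ?case
    by (intro exI[of _ "Suc j"]) auto
qed

lemma gradient_error:
  assumes "bounded (x ` {1..})"
  obtains c where "c > 0" "\<And>k. k \<ge> 1 \<Longrightarrow> norm (g k - grad f (x k)) \<le> c * \<delta> (Suc k)"
proof -
  obtain c where c: "c > 0"
    and err: "\<And>y r. y \<in> x ` {1..} \<Longrightarrow> r \<in> {0<..\<delta> 1} \<Longrightarrow> norm (G y r - grad f y) \<le> c * r"
    using approx assms delta_1 unfolding local_approximation_def by metis
  have "norm (g k - grad f (x k)) \<le> c * \<delta> (Suc k)" if k: "k \<ge> 1" for k
  proof -
    let ?r = "min (\<delta> (Suc k)) (\<nu> k)"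
    have "norm (g k - grad f (x k)) \<le> c * ?r"
      using err[of "x k" ?r] step1_g[OF k] step1_delta[OF k] delta_bounds[of "Suc k"] nu_pos[OF k] k
      by auto
    also have "\<dots> \<le> c * \<delta> (Suc k)"
      using c by (intro mult_left_mono) auto
    finally show ?thesis .
  qed
  then show ?thesis using that c by blast
qed

lemma accepted_norm:
  assumes "k \<ge> 1"
  shows "\<mu> * C k * \<delta> (Suc k) < norm (g k)"
  using step1_accept[OF assms] step1_delta[OF assms] by (simp add: mult.assoc)

text \<open>
  For a failed iteration with \<open>c \<le> C k\<close>, where \<open>c\<close> is the error constant of the approximation, the
  rejected trial step \<open>u\<close> satisfies \<open>1/2 - \<beta> < L * u\<close>: the slope along \<open>g k\<close> is at least half of
  \<open>(norm (g k))\<^sup>2\<close>, so a violated Armijo inequality has to be caused by the second-order remainder.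
  Since \<open>\<gamma> * u < tmin k\<close>, this bounds \<open>tmin k\<close> from below. Infinitely many failures would drive
  \<open>C\<close> to infinity and \<open>tmin\<close> to zero, which contradicts that bound.
\<close>
lemma finitely_many_failures:
  assumes "C1_smooth f" "locally_Lipschitz (grad f)" "bounded (x ` {1..})"
  shows "finite {k. k \<ge> 1 \<and> t k < tmin k}"
proof (rule ccontr)
  assume inf: "infinite {k. k \<ge> 1 \<and> t k < tmin k}"
  obtain c where c: "c > 0"
    and err: "\<And>k. k \<ge> 1 \<Longrightarrow> norm (g k - grad f (x k)) \<le> c * \<delta> (Suc k)"
    using gradient_error assms(3) by blast
  obtain R where R: "\<And>k. k \<ge> 1 \<Longrightarrow> norm (x k) \<le> R"
    using assms(3) unfolding bounded_iff by auto
  obtain B where B: "\<And>y. norm y \<le> R \<Longrightarrow> norm (grad f y) \<le> B"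
  proof -
    have "compact (grad f ` cball 0 R)"
      using assms(1) unfolding C1_smooth_def
      by (intro compact_continuous_image) (auto intro: continuous_on_subset)
    then have "bounded (grad f ` cball 0 R)"
      by (rule compact_imp_bounded)
    then obtain b where "\<And>y. y \<in> cball 0 R \<Longrightarrow> norm (grad f y) \<le> b"
      unfolding bounded_iff by blast
    then show ?thesis
      using that[of b] by simp
  qed
  \<comment> \<open>All trial points lie in one ball, on which the gradient has a single Lipschitz constant.\<close>
  define B' where "B' = B + c * \<delta> 1"
  have g_le: "norm (g k) \<le> B'" if "k \<ge> 1" for k
  proof -
    have "c * \<delta> (Suc k) \<le> c * \<delta> 1"
      using c delta_bounds(2)[of "Suc k"] by (intro mult_left_mono) auto
    moreover have "norm (g k) \<le> norm (grad f (x k)) + norm (g k - grad f (x k))"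
      by (rule norm_triangle_sub)
    ultimately show ?thesis
      using err[OF that] B[OF R[OF that]] by (simp add: B'_def)
  qed
  let ?S = "cball (0::real^'n) (R + \<tau>bar * B')"
  obtain L where L: "L-lipschitz_on ?S (grad f)"
    using assms(2) compact_cball unfolding locally_Lipschitz_def by metis
  have L0: "0 \<le> L"
    using L by (rule lipschitz_on_nonneg)

  have failure: "C k < c \<or> \<gamma> * (1/2 - \<beta>) < L * tmin k" if k: "k \<ge> 1" "t k < tmin k" for k
  proof (rule disjCI)
    assume "\<not> \<gamma> * (1/2 - \<beta>) < L * tmin k"
    show "C k < c"
    proof (rule ccontr)
      assume "\<not> C k < c"
      obtain u where u: "0 < u" "u \<le> \<tau>bar" "\<gamma> * u < tmin k"
        and bad: "f (x k - u *\<^sub>R g k) > f (x k) - \<beta> * u * (norm (g k))\<^sup>2"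
        using linesearch_exit(4)[OF k] by blast
      have dpos: "0 < \<delta> (Suc k)"
        using delta_bounds(1) by simp
      have Cpos: "0 < C k"
        using parameters_mono[of k k] k by simp
      \<comment> \<open>This is where \<open>\<mu> > 2\<close> enters: the error is less than half the norm of \<open>g k\<close>.\<close>
      have "2 * norm (g k - grad f (x k)) \<le> 2 * (C k * \<delta> (Suc k))"
        using err[OF k(1)] mult_right_mono[of c "C k" "\<delta> (Suc k)"] \<open>\<not> C k < c\<close> dpos
        by linarith
      also have "\<dots> \<le> \<mu> * (C k * \<delta> (Suc k))"
        using mu dpos Cpos by (intro mult_right_mono) auto
      also have "\<dots> < norm (g k)"
        using accepted_norm[OF k(1)] by (simp add: mult.assoc)
      finally have half: "2 * norm (g k - grad f (x k)) < norm (g k)" .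
      then have gpos: "0 < norm (g k)"
        by (smt (verit) norm_ge_zero)
      have "g k \<bullet> (g k - grad f (x k)) \<le> norm (g k) * norm (g k - grad f (x k))"
        by (rule norm_cauchy_schwarz)
      also have "\<dots> \<le> norm (g k) * (norm (g k) / 2)"
        using half by (intro mult_left_mono) auto
      finally have slope: "(norm (g k))\<^sup>2 / 2 \<le> g k \<bullet> grad f (x k)"
        by (simp add: inner_diff_right power2_norm_eq_inner power2_eq_square[symmetric])
      have "norm (u *\<^sub>R g k) \<le> \<tau>bar * B'"
        using u g_le[OF k(1)] gpos by (auto intro!: mult_mono)
      then have "norm (x k - u *\<^sub>R g k) \<le> R + \<tau>bar * B'" "norm (x k) \<le> R + \<tau>bar * B'"
        using norm_triangle_ineq4[of "x k" "u *\<^sub>R g k"] R[OF k(1)] norm_ge_zero[of "u *\<^sub>R g k"]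
        by linarith+
      then have in_S: "x k + (- u) *\<^sub>R g k \<in> ?S" "x k \<in> ?S"
        by auto
      have "f (x k + (- u) *\<^sub>R g k) \<le>
          f (x k) + ((- u) *\<^sub>R g k) \<bullet> grad f (x k) + L * (norm ((- u) *\<^sub>R g k))\<^sup>2"
        using assms(1) L in_S unfolding C1_smooth_def
        by (intro lipschitz_gradient_upper_bound[of _ _ ?S]) auto
      moreover have "u * ((norm (g k))\<^sup>2 / 2) \<le> u * (g k \<bullet> grad f (x k))"
        using slope u by (intro mult_left_mono) auto
      ultimately have "0 < (u * (norm (g k))\<^sup>2) * (\<beta> - 1/2 + L * u)"
        using bad by (simp add: power_mult_distrib power2_eq_square algebra_simps)
      moreover have "0 < u * (norm (g k))\<^sup>2"
        using u gpos by simp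
      ultimately have "1/2 - \<beta> < L * u"
        using zero_less_mult_pos by fastforce
      then have "\<gamma> * (1/2 - \<beta>) < L * (\<gamma> * u)"
        using gamma by (simp add: mult.left_commute)
      also have "\<dots> \<le> L * tmin k"
        using L0 u by (intro mult_left_mono) auto
      finally show False
        using \<open>\<not> \<gamma> * (1/2 - \<beta>) < L * tmin k\<close> by simp
    qed
  qed

  have "(\<lambda>n. inverse (\<eta> ^ n)) \<longlonglongrightarrow> 0"
    using eta by (rule LIMSEQ_inverse_realpow_zero)
  then have "(\<lambda>n. c * inverse (\<eta> ^ n)) \<longlonglongrightarrow> 0"
    by (rule tendsto_mult_right_zero)
  then have ev1: "eventually (\<lambda>n. c * inverse (\<eta> ^ n) < C 1) sequentially"
    using C_1 by (rule order_tendstoD)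
  have "(\<lambda>n. \<gamma> ^ n) \<longlonglongrightarrow> 0"
    using gamma by (intro LIMSEQ_realpow_zero) auto
  then have "(\<lambda>n. (L * tmin 1) * \<gamma> ^ n) \<longlonglongrightarrow> 0"
    by (rule tendsto_mult_right_zero)
  then have ev2: "eventually (\<lambda>n. (L * tmin 1) * \<gamma> ^ n < \<gamma> * (1/2 - \<beta>)) sequentially"
    using gamma beta by (intro order_tendstoD) auto
  obtain n where n: "c * inverse (\<eta> ^ n) < C 1" "(L * tmin 1) * \<gamma> ^ n < \<gamma> * (1/2 - \<beta>)"
    using eventually_happens[OF eventually_conj[OF ev1 ev2]] by auto
  obtain k0 where "k0 \<ge> 1" and
    par: "\<And>k. k \<ge> k0 \<Longrightarrow> \<eta> ^ n * C 1 \<le> C k \<and> tmin k \<le> \<gamma> ^ n * tmin 1"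
    using parameters_after_failures[OF inf] by blast
  obtain k where k: "k > k0" "t k < tmin k"
    using inf unfolding infinite_nat_iff_unbounded by blast
  have "c < \<eta> ^ n * C 1"
    using n(1) eta by (simp add: field_simps)
  moreover have "L * tmin k \<le> L * (\<gamma> ^ n * tmin 1)"
    using par[of k] k L0 by (intro mult_left_mono) auto
  ultimately show False
    using failure[of k] par[of k] k n(2) \<open>k0 \<ge> 1\<close> by (auto simp: mult_ac)
qed

end

section \<open>Convergence of descent sequences under the KL inequality\<close>

text \<open>
  A descent method seen only through its values and exact gradients. The first inequality controls
  the length of the path, and hence convergence; the second controls the speed at which the values
  decrease, and hence the rates. The index \<open>K\<close> discards the initial iterations, in which the
  algorithm still adapts its parameters.
\<close>
locale descent_sequence =
  fixes f :: "real^'n \<Rightarrow> real" and x :: "nat \<Rightarrow> real^'n" and K :: nat and a b :: real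
  assumes a_pos: "a > 0" and b_pos: "b > 0"
    and grad_nonzero: "\<And>k. k \<ge> K \<Longrightarrow> grad f (x k) \<noteq> 0"
    and decrease_by_step: "\<And>k. k \<ge> K \<Longrightarrow>
      a * norm (grad f (x k)) * dist (x k) (x (Suc k)) \<le> f (x k) - f (x (Suc k))"
    and decrease_by_gradient: "\<And>k. k \<ge> K \<Longrightarrow>
      b * (norm (grad f (x k)))\<^sup>2 \<le> f (x k) - f (x (Suc k))"

text \<open>
  Past the last failure \<open>C\<close> keeps the value \<open>C K\<close>, and the acceptance test turns the error bound
  \<open>c * \<delta> (Suc k)\<close> into the relative bound \<open>c / (\<mu> * C K) * norm (g k)\<close>. This gives
  \<open>norm (grad f (x k)) \<le> \<kappa> * norm (g k)\<close>, even if the angle between \<open>g k\<close> and the gradient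
  is out of control; the decrease of \<open>f\<close> itself is guaranteed by the Armijo inequality, with step
  sizes bounded below by \<open>tmin K\<close>.
\<close>
lemma (in DFB) eventually_descent_sequence:
  assumes "C1_smooth f" "locally_Lipschitz (grad f)" "bounded (x ` {1..})"
    and "\<And>k. k \<ge> 1 \<Longrightarrow> grad f (x k) \<noteq> 0"
  obtains K a b where "descent_sequence f x K a b"
proof -
  have fin: "finite {k. k \<ge> 1 \<and> t k < tmin k}"
    using assms(1-3) by (rule finitely_many_failures)
  obtain m where m: "\<And>k. k \<ge> 1 \<Longrightarrow> t k < tmin k \<Longrightarrow> k \<le> m"
    using fin unfolding finite_nat_set_iff_bounded_le by auto
  define K where "K = Suc m"
  have K1: "K \<ge> 1"
    by (simp add: K_def)
  have success: "tmin k \<le> t k" if "k \<ge> K" for k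
    using m[of k] that by (force simp: K_def)
  have const: "C k = C K \<and> tmin k = tmin K" if "k \<ge> K" for k
    using that
  proof (induction k rule: dec_induct)
    case (step k)
    then show ?case
      using step3_success[of k] success[of k] K1 by auto
  qed simp
  have pos: "0 < C K" "0 < tmin K"
    using parameters_mono[of K K] K1 by auto
  obtain c where c: "c > 0"
    and err: "\<And>k. k \<ge> 1 \<Longrightarrow> norm (g k - grad f (x k)) \<le> c * \<delta> (Suc k)"
    using gradient_error assms(3) by blast
  define \<kappa> where "\<kappa> = 1 + c / (\<mu> * C K)"
  have \<kappa>: "\<kappa> > 0"
    using c pos mu by (simp add: \<kappa>_def add_pos_pos)
  have grad_le: "norm (grad f (x k)) \<le> \<kappa> * norm (g k)" if k: "k \<ge> K" for k
  proof -
    have "\<mu> * C K * \<delta> (Suc k) < norm (g k)"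
      using accepted_norm[of k] const[OF k] K1 k by simp
    then have "\<delta> (Suc k) \<le> norm (g k) / (\<mu> * C K)"
      using pos mu by (simp add: pos_le_divide_eq mult_ac)
    then have "c * \<delta> (Suc k) \<le> c * (norm (g k) / (\<mu> * C K))"
      using c by (intro mult_left_mono) auto
    moreover have "norm (grad f (x k)) \<le> norm (g k) + norm (g k - grad f (x k))"
      using norm_triangle_sub[of "grad f (x k)" "g k"] by (simp add: norm_minus_commute)
    ultimately show ?thesis
      using err[of k] K1 k by (simp add: \<kappa>_def algebra_simps)
  qed
  have "descent_sequence f x K (\<beta> / \<kappa>) (\<beta> * tmin K / \<kappa>\<^sup>2)"
  proof
    show "\<beta> / \<kappa> > 0" "\<beta> * tmin K / \<kappa>\<^sup>2 > 0"
      using beta pos \<kappa> by auto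
    fix k assume k: "k \<ge> K"
    then have k1: "k \<ge> 1"
      using K1 by simp
    show "grad f (x k) \<noteq> 0"
      using assms(4) k1 .
    have \<tau>: "\<tau> k = t k" "tmin K \<le> \<tau> k" "0 < \<tau> k"
      using step3_success[OF k1 success[OF k]] success[OF k] const[OF k] pos by auto
    have step: "x (Suc k) = x k - \<tau> k *\<^sub>R g k"
      using step4[OF k1] .
    have armijo: "\<beta> * \<tau> k * (norm (g k))\<^sup>2 \<le> f (x k) - f (x (Suc k))"
      using linesearch_exit(3)[OF k1 success[OF k]] \<tau>(1) step by simp
    have "\<beta> / \<kappa> * norm (grad f (x k)) * dist (x k) (x (Suc k))
        = \<beta> * (norm (grad f (x k)) / \<kappa>) * (\<tau> k * norm (g k))"
      using \<tau> by (simp add: step dist_norm)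
    also have "\<dots> \<le> \<beta> * norm (g k) * (\<tau> k * norm (g k))"
      using grad_le[OF k] \<kappa> beta \<tau>
      by (intro mult_right_mono mult_left_mono) (auto simp: pos_divide_le_eq mult_ac)
    also have "\<dots> \<le> f (x k) - f (x (Suc k))"
      using armijo by (simp add: power2_eq_square mult_ac)
    finally show "\<beta> / \<kappa> * norm (grad f (x k)) * dist (x k) (x (Suc k)) \<le> f (x k) - f (x (Suc k))" .
    have "(norm (grad f (x k)))\<^sup>2 \<le> (\<kappa> * norm (g k))\<^sup>2"
      using grad_le[OF k] by (intro power_mono) auto
    then have "(norm (grad f (x k)))\<^sup>2 / \<kappa>\<^sup>2 \<le> (norm (g k))\<^sup>2"
      using \<kappa> by (simp add: pos_divide_le_eq power_mult_distrib mult_ac)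
    then have "\<beta> * tmin K * ((norm (grad f (x k)))\<^sup>2 / \<kappa>\<^sup>2) \<le> \<beta> * \<tau> k * (norm (g k))\<^sup>2"
      using beta \<tau> pos by (intro mult_mono) auto
    then show "\<beta> * tmin K / \<kappa>\<^sup>2 * (norm (grad f (x k)))\<^sup>2 \<le> f (x k) - f (x (Suc k))"
      using armijo by simp
  qed
  then show ?thesis
    by (rule that)
qed

text \<open>
  The trapping argument. The step bound is assumed only inside the neighbourhood \<open>U\<close> of the
  accumulation point, so it first has to be shown that the sequence stays there: starting from an
  index \<open>n\<close> at which both \<open>x n\<close> is close to \<open>z\<close> and the remaining decrease \<open>p n - l\<close> is small, the
  whole remaining path is too short to reach the boundary of the ball.
\<close>
lemma convergent_if_path_controlled_near_limit_point:
  fixes x :: "nat \<Rightarrow> 'a::metric_space" and p :: "nat \<Rightarrow> real"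
  assumes U: "open U" "z \<in> U"
    and r: "strict_mono r" "(x \<circ> r) \<longlonglongrightarrow> z"
    and anti: "\<And>k. k \<ge> K \<Longrightarrow> p (Suc k) \<le> p k"
    and lim: "p \<longlonglongrightarrow> l"
    and control: "\<And>k. k \<ge> K \<Longrightarrow> x k \<in> U \<Longrightarrow> dist (x k) (x (Suc k)) \<le> p k - p (Suc k)"
  shows "x \<longlonglongrightarrow> z" and "\<forall>\<^sub>F k in sequentially. dist (x k) z \<le> p k - l"
proof -
  have p_le: "p m \<le> p k" if "K \<le> k" "k \<le> m" for k m
    using that(2,1) by (induction m rule: dec_induct) (auto intro: order_trans anti)
  have l_le: "l \<le> p k" if "K \<le> k" for k
    using lim p_le[OF that] by (intro LIMSEQ_le_const2[OF lim]) auto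
  obtain e where e: "e > 0" "ball z e \<subseteq> U"
    using U openE by blast
  have "\<forall>\<^sub>F j in sequentially. dist (x (r j)) z < e / 2"
    using tendstoD[OF r(2), of "e / 2"] e by simp
  moreover have "\<forall>\<^sub>F j in sequentially. p (r j) < l + e / 2"
    using LIMSEQ_subseq_LIMSEQ[OF lim r(1)] e
    by (auto simp: o_def dest: order_tendstoD(2)[of _ _ _ "l + e / 2"])
  moreover have "\<forall>\<^sub>F j in sequentially. K \<le> r j"
    using filterlim_subseq[OF r(1)] unfolding filterlim_at_top by blast
  ultimately have "\<forall>\<^sub>F j in sequentially. dist (x (r j)) z < e / 2 \<and> p (r j) < l + e / 2 \<and> K \<le> r j"
    by eventually_elim simp
  then obtain n where n: "dist (x n) z < e / 2" "p n < l + e / 2" "K \<le> n"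
    by (auto dest: eventually_happens)
  have near: "dist (x n) (x k) \<le> p n - p k \<and> x k \<in> U" if "n \<le> k" for k
    using that
  proof (induction k rule: dec_induct)
    case base
    have "x n \<in> ball z e"
      using n e by (simp add: dist_commute)
    then show ?case using e by auto
  next
    case (step k)
    have "dist (x n) (x (Suc k)) \<le> dist (x n) (x k) + dist (x k) (x (Suc k))"
      by (rule dist_triangle)
    also have "\<dots> \<le> p n - p (Suc k)"
      using step control[of k] n by auto
    finally have 1: "dist (x n) (x (Suc k)) \<le> p n - p (Suc k)" .
    have "dist z (x (Suc k)) \<le> dist (x n) z + dist (x n) (x (Suc k))"
      by (metis dist_commute dist_triangle)
    also have "\<dots> < e"
      using 1 n l_le[of "Suc k"] step by linarith
    finally have "x (Suc k) \<in> U"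
      using e by auto
    with 1 show ?case by simp
  qed
  have path: "dist (x k) (x m) \<le> p k - l" if "n \<le> k" "k \<le> m" for k m
  proof -
    have "dist (x k) (x m) \<le> p k - p m"
      using that(2)
    proof (induction m rule: dec_induct)
      case (step m)
      have "dist (x k) (x (Suc m)) \<le> dist (x k) (x m) + dist (x m) (x (Suc m))"
        by (rule dist_triangle)
      then show ?case
        using step control[of m] near[of m] n that by auto
    qed simp
    then show ?thesis
      using l_le[of m] that n by simp
  qed
  have bound: "dist (x k) z \<le> p k - l" if "n \<le> k" for k
  proof (rule LIMSEQ_le_const2)
    show "(\<lambda>j. dist (x k) (x (r j))) \<longlonglongrightarrow> dist (x k) z"
      using r(2) by (auto simp: o_def intro: tendsto_intros)
    show "\<exists>N. \<forall>j\<ge>N. dist (x k) (x (r j)) \<le> p k - l"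
      using path[OF that] seq_suble[OF r(1)] by (meson order_trans)
  qed
  then show ev: "\<forall>\<^sub>F k in sequentially. dist (x k) z \<le> p k - l"
    unfolding eventually_sequentially by blast
  have "(\<lambda>k. dist (x k) z) \<longlonglongrightarrow> 0"
    by (rule tendsto_sandwich[OF _ ev tendsto_const LIM_zero[OF lim]]) simp
  then show "x \<longlonglongrightarrow> z"
    by (subst tendsto_dist_iff)
qed

context descent_sequence
begin

lemma value_strict_decrease:
  assumes "k \<ge> K"
  shows "f (x (Suc k)) < f (x k)"
proof -
  have "0 < b * (norm (grad f (x k)))\<^sup>2"
    using b_pos grad_nonzero[OF assms] by simp
  then show ?thesis
    using decrease_by_gradient[OF assms] by linarith
qed

lemma value_limit:
  assumes "isCont f z" "accumulation_point x z"
  shows "(\<lambda>k. f (x k)) \<longlonglongrightarrow> f z" and "k \<ge> K \<Longrightarrow> f z < f (x k)"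
proof -
  obtain r where r: "strict_mono r" "(x \<circ> r) \<longlonglongrightarrow> z"
    using assms(2) unfolding accumulation_point_def by blast
  have sub: "(\<lambda>j. f (x (r j))) \<longlonglongrightarrow> f z"
    using isCont_tendsto_compose[OF assms(1) r(2)] by (simp add: o_def)
  have anti: "f (x m) \<le> f (x k)" if "K \<le> k" "k \<le> m" for k m
    using that(2,1) by (induction m rule: dec_induct)
      (auto intro: order_trans less_imp_le[OF value_strict_decrease])
  have lower: "f z \<le> f (x k)" if "K \<le> k" for k
    using LIMSEQ_le_const2[OF sub] anti[OF that] seq_suble[OF r(1)] by (meson order_trans)
  show "f z < f (x k)" if "K \<le> k" for k
    using lower[of "Suc k"] value_strict_decrease[OF that] that by simp
  show "(\<lambda>k. f (x k)) \<longlonglongrightarrow> f z"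
  proof (rule order_tendstoI)
    fix y assume "y < f z"
    then show "\<forall>\<^sub>F k in sequentially. y < f (x k)"
      using lower by (auto simp: eventually_sequentially intro: less_le_trans)
  next
    fix y assume "f z < y"
    then have "\<forall>\<^sub>F j in sequentially. f (x (r j)) < y"
      by (rule order_tendstoD(2)[OF sub])
    moreover have "\<forall>\<^sub>F j in sequentially. K \<le> r j"
      using filterlim_subseq[OF r(1)] unfolding filterlim_at_top by blast
    ultimately have "\<forall>\<^sub>F j in sequentially. f (x (r j)) < y \<and> K \<le> r j"
      by eventually_elim simp
    then obtain n where "f (x n) < y" "K \<le> n"
      by (auto dest: eventually_happens)
    then show "\<forall>\<^sub>F k in sequentially. f (x k) < y"
      using anti by (auto simp: eventually_sequentially intro: le_less_trans)
  qed
qed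

text \<open>
  The tangent inequality \<open>desing\<close> takes the place of "concave with derivative \<open>1 / \<psi>\<close>"; it is
  stated for an abstract \<open>\<phi>\<close> so that it covers both the integral of \<open>1 / \<psi>\<close> and explicit
  primitives. Being monotone by \<open>desing\<close> and nonnegative, \<open>\<phi>\<close> converges along
  the values to some \<open>l \<ge> 0\<close>; subtracting \<open>l\<close> would only sharpen the bound on the distance.
\<close>
lemma KL_convergence:
  fixes \<psi> \<phi> :: "real \<Rightarrow> real"
  assumes z: "isCont f z" "accumulation_point x z"
    and U: "open U" "z \<in> U" and \<epsilon>: "\<epsilon> > 0"
    and \<psi>_pos: "\<And>s. 0 < s \<Longrightarrow> s < \<epsilon> \<Longrightarrow> \<psi> s > 0"
    and KL: "\<And>y. y \<in> U \<Longrightarrow> f z < f y \<Longrightarrow> f y < f z + \<epsilon> \<Longrightarrow> \<psi> (f y - f z) \<le> norm (grad f y)"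
    and desing: "\<And>s u. 0 < u \<Longrightarrow> u \<le> s \<Longrightarrow> s < \<epsilon> \<Longrightarrow> (s - u) / \<psi> s \<le> \<phi> s - \<phi> u"
    and \<phi>_nonneg: "\<And>s. 0 < s \<Longrightarrow> s < \<epsilon> \<Longrightarrow> 0 \<le> \<phi> s"
  shows "x \<longlonglongrightarrow> z"
    and "\<forall>\<^sub>F k in sequentially. dist (x k) z \<le> \<phi> (f (x k) - f z) / a"
proof -
  define p where "p k = \<phi> (f (x k) - f z) / a" for k
  have "\<forall>\<^sub>F k in sequentially. f (x k) < f z + \<epsilon>"
    using order_tendstoD(2)[OF value_limit(1)[OF z]] \<epsilon> by simp
  then obtain N where N: "\<And>k. k \<ge> N \<Longrightarrow> f (x k) < f z + \<epsilon>"
    unfolding eventually_sequentially by blast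
  define J where "J = max K N"
  have gap: "0 < f (x k) - f z" "f (x k) - f z < \<epsilon>" "f (x (Suc k)) < f (x k)"
    "0 < f (x (Suc k)) - f z" if "k \<ge> J" for k
    using value_limit(2)[OF z, of k] value_limit(2)[OF z, of "Suc k"] N[of k]
      value_strict_decrease[of k] that
    by (auto simp: J_def)
  have drop: "(f (x k) - f (x (Suc k))) / \<psi> (f (x k) - f z) \<le> a * (p k - p (Suc k))"
    if "k \<ge> J" for k
    using desing[of "f (x (Suc k)) - f z" "f (x k) - f z"] gap[OF that] a_pos
    by (simp add: p_def right_diff_distrib)
  have anti: "p (Suc k) \<le> p k" if k: "k \<ge> J" for k
  proof -
    have "0 \<le> a * (p k - p (Suc k))"
      using drop[OF k] gap[OF k] \<psi>_pos[of "f (x k) - f z"]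
      by (smt (verit) divide_nonneg_pos)
    then show ?thesis
      using a_pos by (simp add: zero_le_mult_iff)
  qed
  have nonneg: "0 \<le> p k" if "k \<ge> J" for k
    using \<phi>_nonneg gap[OF that] a_pos by (simp add: p_def)
  obtain l where "(\<lambda>k. p (k + J)) \<longlonglongrightarrow> l" "\<forall>k. l \<le> p (k + J)"
    using decseq_convergent[of "\<lambda>k. p (k + J)" 0] anti nonneg
    by (auto simp: decseq_Suc_iff)
  then have lim: "p \<longlonglongrightarrow> l"
    by (simp add: LIMSEQ_offset)
  have "0 \<le> l"
    using nonneg by (intro LIMSEQ_le_const[OF lim]) blast
  have control: "dist (x k) (x (Suc k)) \<le> p k - p (Suc k)" if k: "k \<ge> J" "x k \<in> U" for k
  proof -
    let ?s = "f (x k) - f z"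
    have \<psi>: "0 < \<psi> ?s" "\<psi> ?s \<le> norm (grad f (x k))"
      using \<psi>_pos KL[OF k(2)] gap[OF k(1)] by auto
    have "\<psi> ?s * (a * dist (x k) (x (Suc k))) \<le> norm (grad f (x k)) * (a * dist (x k) (x (Suc k)))"
      using \<psi> a_pos by (intro mult_right_mono) auto
    also have "\<dots> \<le> f (x k) - f (x (Suc k))"
      using decrease_by_step[of k] k by (simp add: J_def mult_ac)
    finally have "a * dist (x k) (x (Suc k)) \<le> (f (x k) - f (x (Suc k))) / \<psi> ?s"
      using \<psi> by (simp add: pos_le_divide_eq mult_ac)
    also have "\<dots> \<le> a * (p k - p (Suc k))"
      using drop[OF k(1)] .
    finally show ?thesis
      using a_pos by simp
  qed
  obtain r where r: "strict_mono r" "(x \<circ> r) \<longlonglongrightarrow> z"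
    using z(2) unfolding accumulation_point_def by blast
  note conv = convergent_if_path_controlled_near_limit_point[OF U r anti lim control]
  show "x \<longlonglongrightarrow> z"
    using conv(1) by simp
  have "\<forall>\<^sub>F k in sequentially. dist (x k) z \<le> p k - l"
    using conv(2) by simp
  then show "\<forall>\<^sub>F k in sequentially. dist (x k) z \<le> \<phi> (f (x k) - f z) / a"
    by eventually_elim (use \<open>0 \<le> l\<close> in \<open>simp add: p_def\<close>)
qed

end

section \<open>Desingularizing functions\<close>

text \<open>
  On \<open>{u..<s}\<close> the nonincreasing integrand \<open>1 / \<psi>\<close> is at least its value at the right end.
\<close>
lemma integral_desingularizes:
  fixes \<psi> :: "real \<Rightarrow> real"
  assumes pos: "\<And>s. 0 < s \<Longrightarrow> s < \<epsilon> \<Longrightarrow> \<psi> s > 0"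
    and mono: "mono_on {0<..<\<epsilon>} \<psi>"
    and int: "set_integrable lborel {0<..<\<epsilon>} (\<lambda>s. 1 / \<psi> s)"
    and us: "0 < u" "u \<le> s" "s < \<epsilon>"
  shows "(s - u) / \<psi> s \<le>
    (LINT v:{0<..<s}|lborel. 1 / \<psi> v) - (LINT v:{0<..<u}|lborel. 1 / \<psi> v)"
proof -
  have int': "set_integrable lborel A (\<lambda>s. 1 / \<psi> s)" if "A \<subseteq> {0<..<\<epsilon>}" "A \<in> sets lborel" for A
    using set_integrable_subset[OF int that(2,1)] .
  have split: "{0<..<s} = {0<..<u} \<union> {u..<s}"
    using us by auto
  have "(LINT v:{0<..<s}|lborel. 1 / \<psi> v) =
      (LINT v:{0<..<u}|lborel. 1 / \<psi> v) + (LINT v:{u..<s}|lborel. 1 / \<psi> v)"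
    unfolding split by (intro set_integral_Un int') (use us in auto)
  moreover have "(LINT v:{u..<s}|lborel. 1 / \<psi> s) \<le> (LINT v:{u..<s}|lborel. 1 / \<psi> v)"
  proof (rule set_integral_mono)
    show "set_integrable lborel {u..<s} (\<lambda>v. 1 / \<psi> s)"
      using us unfolding set_integrable_def by simp
    show "set_integrable lborel {u..<s} (\<lambda>v. 1 / \<psi> v)"
      using us by (intro int') auto
    show "1 / \<psi> s \<le> 1 / \<psi> v" if "v \<in> {u..<s}" for v
      using that us pos[of v] mono_onD[OF mono, of v s] by (intro divide_left_mono) (auto simp: pos)
  qed
  moreover have "(LINT v:{u..<s}|lborel. 1 / \<psi> s) = (s - u) / \<psi> s"
    using us by (subst set_integral_const) auto
  ultimately show ?thesis by linarith
qed

text \<open>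
  Tangent inequality for \<open>s powr (1 - q)\<close> at \<open>s\<close>. It is the weighted inequality of arithmetic and
  geometric means for \<open>u\<close> and \<open>s\<close>, divided by \<open>s powr q\<close>.
\<close>
lemma powr_tangent_concave:
  fixes s u q :: real
  assumes "0 < u" "0 < s" "0 \<le> q" "q \<le> 1"
  shows "(1 - q) * (s - u) / s powr q \<le> s powr (1 - q) - u powr (1 - q)"
proof -
  have "u powr (1 - q) * s powr q \<le> (1 - q) * u + q * s"
    using Youngs_inequality_0[of "1 - q" q u s] assms by simp
  moreover have "s powr (1 - q) * s powr q = s"
    using assms by (simp add: powr_add[symmetric])
  ultimately have "(1 - q) * (s - u) \<le> (s powr (1 - q) - u powr (1 - q)) * s powr q"
    by (simp add: algebra_simps)
  then show ?thesis
    using assms by (simp add: pos_divide_le_eq)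
qed

text \<open>
  Tangent inequality for \<open>s powr (- p)\<close> at \<open>s\<close>, obtained from \<open>ln y \<le> y - 1\<close> and
  \<open>1 + y \<le> exp y\<close>.
\<close>
lemma powr_tangent_convex:
  fixes s u p :: real
  assumes "0 < u" "0 < s" "0 \<le> p"
  shows "p * (s - u) * s powr (- p - 1) \<le> u powr (- p) - s powr (- p)"
proof -
  have "p * (1 - u / s) \<le> p * (- ln (u / s))"
    using assms ln_le_minus_one[of "u / s"] by (intro mult_left_mono) auto
  then have "1 + p * (1 - u / s) \<le> exp (- p * ln (u / s))"
    using exp_ge_add_one_self[of "- p * ln (u / s)"] by simp
  then have "1 + p * (1 - u / s) \<le> (u / s) powr (- p)"
    using assms by (simp add: powr_def)
  then have "s powr (- p) * (1 + p * (1 - u / s)) \<le> s powr (- p) * (u / s) powr (- p)"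
    by (intro mult_left_mono) auto
  also have "\<dots> = u powr (- p)"
    using assms by (simp add: powr_mult[symmetric])
  finally show ?thesis
    using assms by (simp add: powr_diff field_simps)
qed

section \<open>Rates of decay\<close>

text \<open>
  The recursion says \<open>r (Suc k) \<le> (1 - c) * r k\<close>; positivity of \<open>r\<close> forces \<open>c < 1\<close>.
\<close>
lemma linear_decay:
  fixes r :: "nat \<Rightarrow> real"
  assumes pos: "\<And>k. k \<ge> N \<Longrightarrow> 0 < r k"
    and step: "\<And>k. k \<ge> N \<Longrightarrow> r (Suc k) \<le> r k - c * r k"
    and c: "0 < c" and e: "0 < e"
  obtains A \<rho> where "A > 0" "0 < \<rho>" "\<rho> < 1" "\<And>k. k \<ge> N \<Longrightarrow> r k powr e \<le> A * \<rho> ^ k"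
proof -
  have "0 < (1 - c) * r N"
    using pos[of "Suc N"] step[of N] by (simp add: algebra_simps)
  then have c1: "c < 1"
    using pos[of N] by (simp add: zero_less_mult_iff)
  define \<rho> where "\<rho> = (1 - c) powr e"
  have \<rho>: "0 < \<rho>" "\<rho> < 1"
    using c c1 e powr_less_mono2[of e "1 - c" 1] by (auto simp: \<rho>_def)
  have le: "r k powr e * \<rho> ^ N \<le> r N powr e * \<rho> ^ k" if "k \<ge> N" for k
    using that
  proof (induction k rule: dec_induct)
    case (step k)
    have "r (Suc k) \<le> (1 - c) * r k"
      using assms(2)[of k] step by (simp add: algebra_simps)
    then have "r (Suc k) powr e \<le> ((1 - c) * r k) powr e"
      using e pos[of "Suc k"] step by (intro powr_mono2) auto
    also have "\<dots> = \<rho> * r k powr e"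
      using c1 pos[of k] step by (simp add: powr_mult \<rho>_def)
    finally have "r (Suc k) powr e * \<rho> ^ N \<le> \<rho> * (r k powr e * \<rho> ^ N)"
      using \<rho> by (simp add: mult.assoc[symmetric] mult_right_mono)
    also have "\<dots> \<le> \<rho> * (r N powr e * \<rho> ^ k)"
      using step \<rho> by (intro mult_left_mono) auto
    finally show ?case
      by (simp add: mult_ac)
  qed simp
  have "r k powr e \<le> r N powr e / \<rho> ^ N * \<rho> ^ k" if "k \<ge> N" for k
    using le[OF that] \<rho> by (simp add: field_simps)
  moreover have "r N powr e / \<rho> ^ N > 0"
    using pos[of N] \<rho> by simp
  ultimately show ?thesis
    using that \<rho> by blast
qed

text \<open>
  By convexity of \<open>s powr (- p)\<close>, a decrease of \<open>r\<close> by \<open>c * r k powr (1 + p)\<close> increases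
  \<open>r powr (- p)\<close> by at least \<open>p * c\<close>: the powers of \<open>r k\<close> cancel exactly.
\<close>
lemma polynomial_decay:
  fixes r :: "nat \<Rightarrow> real"
  assumes pos: "\<And>k. k \<ge> N \<Longrightarrow> 0 < r k"
    and step: "\<And>k. k \<ge> N \<Longrightarrow> r (Suc k) \<le> r k - c * r k powr (1 + p)"
    and c: "0 < c" and p: "0 < p" and e: "0 \<le> e"
  shows "(\<lambda>k. r k powr e) \<in> O(\<lambda>k. real k powr (- (e / p)))"
proof -
  have growth: "p * c * (real k - real N) \<le> r k powr (- p)" if "k \<ge> N" for k
    using that
  proof (induction k rule: dec_induct)
    case (step k)
    have "r k powr (1 + p) * r k powr (- p - 1) = 1"
      using pos[of k] step by (simp add: powr_add[symmetric])
    then have "p * c = p * (c * r k powr (1 + p)) * r k powr (- p - 1)"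
      by simp
    also have "\<dots> \<le> p * (r k - r (Suc k)) * r k powr (- p - 1)"
      using assms(2)[of k] step p by (intro mult_right_mono mult_left_mono) auto
    also have "\<dots> \<le> r (Suc k) powr (- p) - r k powr (- p)"
      using pos[of k] pos[of "Suc k"] step p by (intro powr_tangent_convex) auto
    finally show ?case
      using step by (simp add: algebra_simps)
  qed simp
  have "\<forall>\<^sub>F k in sequentially.
      norm (r k powr e) \<le> (p * c / 2) powr (- (e / p)) * norm (real k powr (- (e / p)))"
    using eventually_ge_at_top[of "2 * N + 1"]
  proof eventually_elim
    case (elim k)
    \<comment> \<open>Beyond \<open>2 * N\<close> the shift by \<open>N\<close> costs at most a factor \<open>2\<close>.\<close>
    have "p * c * (real k / 2) \<le> p * c * (real k - real N)"
      using elim p c by (intro mult_left_mono) auto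
    then have "p * c / 2 * real k \<le> p * c * (real k - real N)"
      by simp
    also have "\<dots> \<le> r k powr (- p)"
      using growth elim by simp
    finally have "(r k powr (- p)) powr (- (e / p)) \<le> (p * c / 2 * real k) powr (- (e / p))"
      using p c e elim by (intro powr_mono2') auto
    also have "\<dots> = (p * c / 2) powr (- (e / p)) * real k powr (- (e / p))"
      by (rule powr_mult)
    finally show ?case
      using p by (simp add: powr_powr)
  qed
  then show ?thesis
    by (rule bigoI)
qed

context descent_sequence
begin

lemma KL_property_convergence:
  assumes "isCont f z" "accumulation_point x z" "KL_property f z"
  shows "x \<longlonglongrightarrow> z"
proof -
  obtain \<psi> \<epsilon> U where \<epsilon>: "\<epsilon> > 0" and U: "open U" "z \<in> U"
    and pos: "\<forall>s\<in>{0<..<\<epsilon>}. \<psi> s > 0"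
    and mono: "mono_on {0<..<\<epsilon>} \<psi>"
    and int: "set_integrable lborel {0<..<\<epsilon>} (\<lambda>s. 1 / \<psi> s)"
    and KL: "\<forall>y\<in>U. f z < f y \<and> f y < f z + \<epsilon> \<longrightarrow> \<psi> (f y - f z) \<le> norm (grad f y)"
    using assms(3) unfolding KL_property_def KL_property_with_def by blast
  have \<psi>_pos: "\<And>s. 0 < s \<Longrightarrow> s < \<epsilon> \<Longrightarrow> \<psi> s > 0"
    using pos by simp
  define \<phi> where "\<phi> s = (LINT v:{0<..<s}|lborel. 1 / \<psi> v)" for s
  show ?thesis
  proof (rule KL_convergence(1)[OF assms(1,2) U \<epsilon> \<psi>_pos KL[rule_format, OF _ conjI]])
    show "(s - u) / \<psi> s \<le> \<phi> s - \<phi> u" if "0 < u" "u \<le> s" "s < \<epsilon>" for s u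
      using integral_desingularizes[OF \<psi>_pos mono int that] by (simp add: \<phi>_def)
    show "0 \<le> \<phi> s" if "0 < s" "s < \<epsilon>" for s
      using that \<psi>_pos unfolding \<phi>_def set_lebesgue_integral_def
      by (intro integral_nonneg_AE AE_I2) (auto simp: indicator_def less_imp_le)
  qed
qed

text \<open>
  For \<open>\<psi> s = M * s powr q\<close> the primitive of \<open>1 / \<psi>\<close> is \<open>s powr (1 - q) / (M * (1 - q))\<close>, and the
  KL inequality inserted into the bound by the squared gradient gives the recursion.
\<close>
lemma KL_powr_estimates:
  assumes z: "isCont f z" "accumulation_point x z"
    and M: "M > 0" and q: "0 < q" "q < 1"
    and KLM: "KL_property_with f z (\<lambda>s. M * s powr q)"
  shows "\<forall>\<^sub>F k in sequentially. dist (x k) z \<le> (f (x k) - f z) powr (1 - q) / (M * (1 - q) * a)"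
    and "\<forall>\<^sub>F k in sequentially. b * M\<^sup>2 * (f (x k) - f z) powr (2 * q) \<le> f (x k) - f (x (Suc k))"
proof -
  obtain \<epsilon> U where \<epsilon>: "\<epsilon> > 0" and U: "open U" "z \<in> U"
    and KL: "\<forall>y\<in>U. f z < f y \<and> f y < f z + \<epsilon> \<longrightarrow> M * (f y - f z) powr q \<le> norm (grad f y)"
    using KLM unfolding KL_property_with_def by blast
  have desing: "(s - u) / (M * s powr q) \<le>
      s powr (1 - q) / (M * (1 - q)) - u powr (1 - q) / (M * (1 - q))"
    if "0 < u" "u \<le> s" "s < \<epsilon>" for s u
  proof -
    have "(s - u) / (M * s powr q) = (1 - q) * (s - u) / s powr q / (M * (1 - q))"
      using q M that by (simp add: field_simps)
    also have "\<dots> \<le> (s powr (1 - q) - u powr (1 - q)) / (M * (1 - q))"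
      using q M that by (intro divide_right_mono powr_tangent_concave) auto
    finally show ?thesis
      by (simp add: diff_divide_distrib)
  qed
  note conv = KL_convergence[OF z U \<epsilon> _ KL[rule_format, OF _ conjI] desing]
  have "\<forall>\<^sub>F k in sequentially. dist (x k) z \<le> (f (x k) - f z) powr (1 - q) / (M * (1 - q)) / a"
    using conv(2) M q by simp
  then show "\<forall>\<^sub>F k in sequentially.
      dist (x k) z \<le> (f (x k) - f z) powr (1 - q) / (M * (1 - q) * a)"
    by simp
  have "x \<longlonglongrightarrow> z"
    using conv(1) M q by simp
  then have "\<forall>\<^sub>F k in sequentially. x k \<in> U"
    using U by (rule topological_tendstoD)
  moreover have "\<forall>\<^sub>F k in sequentially. f (x k) < f z + \<epsilon>"
    using order_tendstoD(2)[OF value_limit(1)[OF z]] \<epsilon> by simp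
  ultimately show "\<forall>\<^sub>F k in sequentially.
      b * M\<^sup>2 * (f (x k) - f z) powr (2 * q) \<le> f (x k) - f (x (Suc k))"
    using eventually_ge_at_top[of K]
  proof eventually_elim
    case (elim k)
    let ?s = "f (x k) - f z"
    have s: "0 < ?s"
      using value_limit(2)[OF z elim(3)] by simp
    have "M\<^sup>2 * ?s powr (2 * q) = (M * ?s powr q)\<^sup>2"
      using s by (simp add: power_mult_distrib power2_eq_square powr_add[symmetric])
    also have "\<dots> \<le> (norm (grad f (x k)))\<^sup>2"
      using KL[rule_format, of "x k"] elim s M by (intro power_mono) auto
    finally have "b * (M\<^sup>2 * ?s powr (2 * q)) \<le> b * (norm (grad f (x k)))\<^sup>2"
      using b_pos by (intro mult_left_mono) auto
    then show ?case
      using decrease_by_gradient[OF elim(3)] by (simp add: mult.assoc)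
  qed
qed

text \<open>
  Combines the distance bound of order \<open>r powr (1 - q)\<close> with the recursion for the value gap \<open>r\<close>.
  For \<open>q \<le> 1/2\<close> and \<open>r k < 1\<close>, \<open>r k\<close> is at most \<open>r k powr (2 * q)\<close>, so the recursion is at least
  geometric; for \<open>q > 1/2\<close> it is that of \<open>polynomial_decay\<close> with exponent \<open>p = 2 * q - 1\<close>.
\<close>
lemma KL_powr_rates:
  assumes z: "isCont f z" "accumulation_point x z"
    and M: "M > 0" and q: "0 < q" "q < 1"
    and KLM: "KL_property_with f z (\<lambda>s. M * s powr q)"
  shows "q \<le> 1/2 \<Longrightarrow> converges_linearly x z"
    and "q > 1/2 \<Longrightarrow>
      (\<lambda>k. norm (x k - z)) \<in> O(\<lambda>k. real k powr (- ((1 - q) / (2 * q - 1))))"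
proof -
  define r where "r k = f (x k) - f z" for k
  define D where "D = 1 / (M * (1 - q) * a)"
  have D: "D > 0"
    using M q a_pos by (simp add: D_def)
  have dist: "\<forall>\<^sub>F k in sequentially. norm (x k - z) \<le> D * r k powr (1 - q)"
    using KL_powr_estimates(1)[OF assms] by (simp add: r_def D_def dist_norm)
  define c where "c = b * M\<^sup>2"
  have c: "c > 0"
    using b_pos M by (simp add: c_def)
  have "\<forall>\<^sub>F k in sequentially. r (Suc k) \<le> r k - c * r k powr (2 * q)"
    using KL_powr_estimates(2)[OF assms] by eventually_elim (simp add: r_def c_def)
  moreover have "\<forall>\<^sub>F k in sequentially. r k < 1"
    using order_tendstoD(2)[OF value_limit(1)[OF z], of "f z + 1"]
    by (simp add: r_def algebra_simps)
  moreover have "\<forall>\<^sub>F k in sequentially. 0 < r k"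
    using eventually_ge_at_top[of K]
    by eventually_elim (use value_limit(2)[OF z] in \<open>simp add: r_def\<close>)
  ultimately have "\<forall>\<^sub>F k in sequentially.
      r (Suc k) \<le> r k - c * r k powr (2 * q) \<and> r k < 1 \<and> 0 < r k"
    by eventually_elim simp
  then obtain N where N: "\<And>k. k \<ge> N \<Longrightarrow>
      r (Suc k) \<le> r k - c * r k powr (2 * q) \<and> r k < 1 \<and> 0 < r k"
    unfolding eventually_sequentially by blast
  show "converges_linearly x z" if "q \<le> 1/2"
  proof -
    have step: "r (Suc k) \<le> r k - c * r k" if k: "k \<ge> N" for k
    proof -
      have "r k powr 1 \<le> r k powr (2 * q)"
        using N[OF k] \<open>q \<le> 1/2\<close> by (intro powr_mono') auto
      then have "c * r k \<le> c * r k powr (2 * q)"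
        using c N[OF k] by simp
      then show ?thesis
        using N[OF k] by linarith
    qed
    obtain A \<rho> where A: "A > 0" and \<rho>: "0 < \<rho>" "\<rho> < 1"
      and decay: "\<And>k. k \<ge> N \<Longrightarrow> r k powr (1 - q) \<le> A * \<rho> ^ k"
      using linear_decay[of N r c "1 - q"] N step c q by auto
    have "\<forall>\<^sub>F k in sequentially. norm (x k - z) \<le> D * A * \<rho> ^ k"
      using dist eventually_ge_at_top[of N]
    proof eventually_elim
      case (elim k)
      have "D * r k powr (1 - q) \<le> D * (A * \<rho> ^ k)"
        using decay[OF elim(2)] D by (intro mult_left_mono) auto
      then show ?case
        using elim(1) by (simp add: mult.assoc)
    qed
    moreover have "D * A > 0" "\<rho> \<in> {0<..<1}"
      using D A \<rho> by auto
    ultimately show ?thesis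
      unfolding converges_linearly_def by blast
  qed
  show "(\<lambda>k. norm (x k - z)) \<in> O(\<lambda>k. real k powr (- ((1 - q) / (2 * q - 1))))" if "q > 1/2"
  proof -
    have "(\<lambda>k. norm (x k - z)) \<in> O(\<lambda>k. r k powr (1 - q))"
      using dist by (intro bigoI[of _ D]) simp
    also have "(\<lambda>k. r k powr (1 - q)) \<in> O(\<lambda>k. real k powr (- ((1 - q) / (2 * q - 1))))"
      using N c q that by (intro polynomial_decay[of N r c]) auto
    finally show ?thesis .
  qed
qed

end

theorem theorem5p5:
  fixes f :: "real^'n \<Rightarrow> real"
    and G :: "real^'n \<Rightarrow> real \<Rightarrow> real^'n"
    and \<theta> \<mu> \<eta> \<beta> \<gamma> \<tau>bar :: real
    and \<nu> :: "nat \<Rightarrow> real"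
    and x g :: "nat \<Rightarrow> real^'n"
    and i :: "nat \<Rightarrow> nat"
    and \<delta> C tmin t \<tau> :: "nat \<Rightarrow> real"
  assumes "C1_smooth f"
    and "locally_Lipschitz (grad f)"
    and "DFB f G \<theta> \<mu> \<eta> \<beta> \<gamma> \<tau>bar \<nu> x g i \<delta> C tmin t \<tau>"
    and "\<And>k. k \<ge> 1 \<Longrightarrow> grad f (x k) \<noteq> 0"
    and "bounded (x ` {1..})"
  shows "\<forall>xbar. accumulation_point x xbar \<and> KL_property f xbar \<longrightarrow>
    (x \<longlonglongrightarrow> xbar) \<and>
    (\<forall>M q. M > 0 \<and> 0 < q \<and> q < 1 \<and> KL_property_with f xbar (\<lambda>s. M * s powr q) \<longrightarrow>
       (q \<le> 1/2 \<longrightarrow> converges_linearly x xbar) \<and>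
       (q > 1/2 \<longrightarrow>
          (\<lambda>k. norm (x k - xbar)) \<in> O(\<lambda>k. real k powr (- ((1 - q) / (2 * q - 1))))))"
proof -
  interpret DFB f G \<theta> \<mu> \<eta> \<beta> \<gamma> \<tau>bar \<nu> x g i \<delta> C tmin t \<tau>
    by (fact assms(3))
  obtain K a b where "descent_sequence f x K a b"
    using eventually_descent_sequence assms by blast
  then interpret descent_sequence f x K a b .
  show ?thesis
    using KL_property_convergence KL_powr_rates C1_smooth_isCont[OF assms(1)] by blast
qed

end
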